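(* Let $X$ and $Y$ be complex normed spaces and let $T:X\to Y$ be a non-zero bounded linear mapping. The following conditions are equivalent: (i) $T$ preserves $\rho_\infty$-orthogonality, i.e. for all $x,y\in X$, $\rho_\infty(x,y)=0$ implies $\rho_\infty(Tx,Ty)=0$; (ii) $\|Tx\|=\|T\|\,\|x\|$ for all $x\in X$; (iii) $\rho_\infty(Tx,Ty)=\|T\|^2\rho_\infty(x,y)$ for all $x,y\in X$. If $X=Y$, then each one of these assertions is also equivalent to (iv) there exists a semi-inner product $[\cdot,\cdot]:X\times X\to\mathbb{C}$ (generating the norm of $X$) satisfying $[Tx,Ty]=\|T\|^2[x,y]$ for all $x,y\in X$.
   Context: For a complex normed space $Z$ and $x,y\in Z$, the right norm derivative is $\rho_{+}(x,y)=\lim_{t\to0^{+}}\frac{\|x+ty\|^2-\|x\|^2}{2t}\in\mathbb{R}$, and $$\rho_{\infty}(x,y)=\frac1\pi\int_0^{2\pi}e^{i\theta}\rho_{+}(x,e^{i\theta}y)\,d\theta\in\mathbb{C};$$ the same symbol $\rho_\infty$ is used in $X$ and in $Y$. $\|T\|$ is the operator norm. A semi-inner product in $X$ generating the norm is a map $[\cdot,\cdot]:X\times X\to\mathbb{C}$ such that for all $x,y,z\in X$, $\alpha\in\mathbb{C}$: $[\alpha x+y,z]=\alpha[x,z]+[y,z]$; $[x,\alpha y]=\overline{\alpha}[x,y]$; $[x,x]=\|x\|^2$; $|[x,y]|\le\|x\|\|y\|$. *)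

theory Defs
  imports "HOL-Analysis.Analysis"
begin

text \<open>
  The distribution only has real normed spaces. A complex normed space is a real normed space
  with a complex scalar multiplication extending the real one; topology and operator norm
  (\<^const>\<open>onorm\<close>) are then those of the underlying real space.
\<close>

class complex_normed_vector = real_normed_vector +
  fixes scaleC :: "complex \<Rightarrow> 'a \<Rightarrow> 'a"  (infixr "*\<^sub>C" 75)
  assumes scaleC_add_right: "a *\<^sub>C (x + y) = a *\<^sub>C x + a *\<^sub>C y"
    and scaleC_add_left: "(a + b) *\<^sub>C x = a *\<^sub>C x + b *\<^sub>C x"
    and scaleC_scaleC: "a *\<^sub>C b *\<^sub>C x = (a * b) *\<^sub>C x"
    and scaleC_one: "1 *\<^sub>C x = x"
    and scaleC_of_real: "complex_of_real r *\<^sub>C x = r *\<^sub>R x"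
    and norm_scaleC: "norm (a *\<^sub>C x) = cmod a * norm x"

instantiation complex :: complex_normed_vector
begin

definition scaleC_complex_def: "a *\<^sub>C x = a * (x :: complex)"

instance
  by standard (simp_all add: scaleC_complex_def algebra_simps norm_mult scaleR_conv_of_real)

end

locale bounded_clinear = bounded_linear T
  for T :: "'a::complex_normed_vector \<Rightarrow> 'b::complex_normed_vector" +
  assumes scaleC: "T (a *\<^sub>C x) = a *\<^sub>C T x"

text \<open>
  The difference quotient below always converges, because \<open>t \<mapsto> norm (x + t *\<^sub>R y)\<close> is convex,
  so \<^const>\<open>Lim\<close> denotes a genuine limit. Moreover \<open>rho_plus x\<close> is Lipschitz in its second
  argument, so the integrand in \<open>rho_inf\<close> is continuous.
\<close>

definition rho_plus :: "'a::complex_normed_vector \<Rightarrow> 'a \<Rightarrow> real" where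
  "rho_plus x y = Lim (at_right 0) (\<lambda>t. ((norm (x + t *\<^sub>R y))\<^sup>2 - (norm x)\<^sup>2) / (2 * t))"

definition rho_inf :: "'a::complex_normed_vector \<Rightarrow> 'a \<Rightarrow> complex" where
  "rho_inf x y = complex_of_real (1 / pi) *
     integral {0..2 * pi} (\<lambda>\<theta>. exp (\<i> * complex_of_real \<theta>) *
       complex_of_real (rho_plus x (exp (\<i> * complex_of_real \<theta>) *\<^sub>C y)))"

definition preserves_rho_inf_orthogonality ::
    "('a::complex_normed_vector \<Rightarrow> 'b::complex_normed_vector) \<Rightarrow> bool" where
  "preserves_rho_inf_orthogonality T \<longleftrightarrow>
     (\<forall>x y. rho_inf x y = 0 \<longrightarrow> rho_inf (T x) (T y) = 0)"

definition semi_inner_product :: "('a::complex_normed_vector \<Rightarrow> 'a \<Rightarrow> complex) \<Rightarrow> bool" where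
  "semi_inner_product s \<longleftrightarrow>
     (\<forall>a x y z. s (a *\<^sub>C x + y) z = a * s x z + s y z) \<and>
     (\<forall>a x y. s x (a *\<^sub>C y) = cnj a * s x y) \<and>
     (\<forall>x. s x x = complex_of_real ((norm x)\<^sup>2)) \<and>
     (\<forall>x y. cmod (s x y) \<le> norm x * norm y)"

end

theory Submission
  imports Defs
begin

text \<open>
  The function \<open>a \<mapsto> rho_plus x (a *\<^sub>C y)\<close> is sublinear on the complex plane, i.e. the support
  function of a convex set, and \<open>rho_inf x y\<close> is the conjugate of the Steiner point of that set.
  Hence \<open>Re (rho_inf x y)\<close> lies between \<open>- rho_plus x (- y)\<close> and \<open>rho_plus x y\<close>, so
  \<open>Re (rho_inf x y) / norm x\<close> is a subgradient of the norm at \<open>x\<close> in direction \<open>y\<close>.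

  Since \<open>rho_inf x (a *\<^sub>C x + y) = cnj a * (norm x)\<^sup>2 + rho_inf x y\<close>, preservation of orthogonality
  forces \<open>rho_inf (T x) (T y) / (norm (T x))\<^sup>2 = rho_inf x y / (norm x)\<^sup>2\<close>. Along a segment the convex
  functions \<open>norm x\<close> and \<open>norm (T x)\<close> therefore share a selection of logarithmic subgradients, so
  their quotient is constant.

  For the last condition, a semi-inner product exists by Hahn--Banach; averaging it over the powers
  of the isometry \<open>T / onorm T\<close> and passing to a cluster point of the averages makes it invariant.
\<close>

subsection \<open>The right norm derivative\<close>

lemma scaleC_zero_left [simp]: "0 *\<^sub>C x = (0 :: 'a::complex_normed_vector)"
  using norm_scaleC[of 0 x] by simp

lemma scaleC_zero_right [simp]: "a *\<^sub>C 0 = (0 :: 'a::complex_normed_vector)"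
  using norm_scaleC[of a "0 :: 'a"] by simp

lemma scaleC_minus_left: "(- a) *\<^sub>C x = - (a *\<^sub>C (x :: 'a::complex_normed_vector))"
  using scaleC_add_left[of a "- a" x] by (metis add.right_inverse minus_unique scaleC_zero_left)

lemma scaleC_diff_left: "(a - b) *\<^sub>C x = a *\<^sub>C x - b *\<^sub>C (x :: 'a::complex_normed_vector)"
  using scaleC_add_left[of a "- b" x] by (simp add: scaleC_minus_left)

text \<open>Convexity of the norm: the point at parameter \<open>s\<close> is the convex combination
  of \<open>x\<close> and the point at parameter \<open>t\<close> with weight \<open>s / t\<close>
  on the latter.\<close>

lemma norm_quotient_mono:
  fixes x y :: "'a::real_normed_vector"
  assumes "0 < s" "s \<le> t"
  shows "(norm (x + s *\<^sub>R y) - norm x) / s \<le> (norm (x + t *\<^sub>R y) - norm x) / t"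
proof -
  have "x + s *\<^sub>R y = (1 - s / t) *\<^sub>R x + (s / t) *\<^sub>R (x + t *\<^sub>R y)"
    using assms by (simp add: algebra_simps)
  then have "norm (x + s *\<^sub>R y) \<le> norm ((1 - s / t) *\<^sub>R x) + norm ((s / t) *\<^sub>R (x + t *\<^sub>R y))"
    by (metis norm_triangle_ineq)
  also have "\<dots> = (1 - s / t) * norm x + (s / t) * norm (x + t *\<^sub>R y)"
    using assms by simp
  finally show ?thesis
    using assms by (simp add: field_simps)
qed

text \<open>The chord slopes decrease as \<open>t\<close> decreases and stay above
  \<open>- norm y\<close>, so they converge to their infimum \<open>N\<close>.\<close>

lemma norm_quotient_limit:
  fixes x y :: "'a::real_normed_vector"
  obtains N where "((\<lambda>t. (norm (x + t *\<^sub>R y) - norm x) / t) \<longlongrightarrow> N) (at_right 0)"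
    and "\<And>t. 0 < t \<Longrightarrow> N \<le> (norm (x + t *\<^sub>R y) - norm x) / t"
proof -
  let ?n = "\<lambda>t. (norm (x + t *\<^sub>R y) - norm x) / t"
  have bnd: "- norm y \<le> ?n t" if "0 < t" for t
  proof -
    have "norm x - norm (t *\<^sub>R y) \<le> norm (x + t *\<^sub>R y)" by (rule norm_diff_ineq)
    with that show ?thesis by (simp add: field_simps)
  qed
  have lim: "(?n \<longlongrightarrow> Inf (?n ` ({0<..} \<inter> UNIV))) (at 0 within ({0<..} \<inter> UNIV))"
    by (rule Lim_right_bound[where K = "- norm y"]) (auto intro: norm_quotient_mono bnd)
  have "Inf (?n ` {0<..}) \<le> ?n t" if "0 < t" for t
    by (rule cInf_lower) (use that bnd in \<open>auto intro!: bdd_belowI2\<close>)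
  with lim that show thesis by simp
qed

text \<open>The difference of squares factors into a chord slope times the mean of two norms, and
  that mean tends to \<open>norm x\<close>. Hence \<open>rho_plus x y\<close> is
  \<open>norm x\<close> times the one-sided derivative of the norm.\<close>

lemma rho_plus_tendsto:
  "((\<lambda>t. ((norm (x + t *\<^sub>R y))\<^sup>2 - (norm x)\<^sup>2) / (2 * t)) \<longlongrightarrow> rho_plus x y) (at_right 0)"
  and rho_plus_le_quotient:
  "0 < t \<Longrightarrow> rho_plus x y \<le> norm x * ((norm (x + t *\<^sub>R y) - norm x) / t)"
proof -
  obtain N where N: "((\<lambda>t. (norm (x + t *\<^sub>R y) - norm x) / t) \<longlongrightarrow> N) (at_right 0)"
    and le: "\<And>t. 0 < t \<Longrightarrow> N \<le> (norm (x + t *\<^sub>R y) - norm x) / t"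
    using norm_quotient_limit[of x y] by blast
  have "((\<lambda>t. (norm (x + t *\<^sub>R y) - norm x) / t * ((norm (x + t *\<^sub>R y) + norm x) / 2))
     \<longlongrightarrow> N * ((norm (x + 0 *\<^sub>R y) + norm x) / 2)) (at_right 0)"
    by (intro tendsto_intros N) auto
  moreover have "(\<lambda>t. (norm (x + t *\<^sub>R y) - norm x) / t * ((norm (x + t *\<^sub>R y) + norm x) / 2))
     = (\<lambda>t. ((norm (x + t *\<^sub>R y))\<^sup>2 - (norm x)\<^sup>2) / (2 * t))"
    by (intro ext) (simp add: power2_eq_square field_simps)
  ultimately have lim:
    "((\<lambda>t. ((norm (x + t *\<^sub>R y))\<^sup>2 - (norm x)\<^sup>2) / (2 * t)) \<longlongrightarrow> norm x * N) (at_right 0)"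
    by (simp add: mult.commute)
  then have eq: "rho_plus x y = norm x * N"
    unfolding rho_plus_def by (intro tendsto_Lim) auto
  show "((\<lambda>t. ((norm (x + t *\<^sub>R y))\<^sup>2 - (norm x)\<^sup>2) / (2 * t)) \<longlongrightarrow> rho_plus x y) (at_right 0)"
    using lim by (simp add: eq)
  show "rho_plus x y \<le> norm x * ((norm (x + t *\<^sub>R y) - norm x) / t)" if "0 < t"
    unfolding eq by (intro mult_left_mono le that norm_ge_zero)
qed

lemma rho_plus_eqI:
  "((\<lambda>t. ((norm (x + t *\<^sub>R y))\<^sup>2 - (norm x)\<^sup>2) / (2 * t)) \<longlongrightarrow> l) (at_right 0) \<Longrightarrow> rho_plus x y = l"
  by (rule tendsto_unique[OF trivial_limit_at_right_real rho_plus_tendsto])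

lemma rho_plus_scaleC_self: "rho_plus x (a *\<^sub>C x) = Re a * (norm x)\<^sup>2"
proof (rule rho_plus_eqI)
  have eq: "((norm (x + t *\<^sub>R a *\<^sub>C x))\<^sup>2 - (norm x)\<^sup>2) / (2 * t) = (Re a + t * (cmod a)\<^sup>2 / 2) * (norm x)\<^sup>2"
    if "0 < t" for t
  proof -
    have "x + t *\<^sub>R a *\<^sub>C x = (1 + of_real t * a) *\<^sub>C x"
      by (simp flip: scaleC_of_real add: scaleC_scaleC scaleC_add_left scaleC_one)
    then have "(norm (x + t *\<^sub>R a *\<^sub>C x))\<^sup>2 = (cmod (1 + of_real t * a))\<^sup>2 * (norm x)\<^sup>2"
      by (simp add: norm_scaleC power_mult_distrib)
    also have "(cmod (1 + of_real t * a))\<^sup>2 = 1 + 2 * t * Re a + t\<^sup>2 * (cmod a)\<^sup>2"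
      unfolding cmod_power2 by (simp add: power2_eq_square algebra_simps)
    finally show ?thesis using that by (simp add: field_simps power2_eq_square)
  qed
  have "((\<lambda>t. (Re a + t * (cmod a)\<^sup>2 / 2) * (norm x)\<^sup>2) \<longlongrightarrow> (Re a + 0 * (cmod a)\<^sup>2 / 2) * (norm x)\<^sup>2) (at_right 0)"
    by (intro tendsto_intros) auto
  then show "((\<lambda>t. ((norm (x + t *\<^sub>R a *\<^sub>C x))\<^sup>2 - (norm x)\<^sup>2) / (2 * t)) \<longlongrightarrow> Re a * (norm x)\<^sup>2) (at_right 0)"
    by (subst tendsto_cong[OF eventually_at_rightI[of 0 1]]) (use eq in auto)
qed

lemma filterlim_mult_at_right_0: "0 < c \<Longrightarrow> filterlim (\<lambda>t. c * t) (at_right 0) (at_right (0::real))"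
  using filterlim_times_pos[of "\<lambda>t. t" 0 "at_right 0" c "0::real"] by (simp add: filterlim_ident)

text \<open>\<open>x + t (y + z)\<close> is the midpoint of \<open>x + 2 t y\<close> and
  \<open>x + 2 t z\<close>, and the squared norm is convex. The quotients on the right are therefore
  taken at \<open>2 * t\<close>, which leaves their limits unchanged.\<close>

lemma rho_plus_subadditive: "rho_plus x (y + z) \<le> rho_plus x y + rho_plus x z"
proof (rule tendsto_le)
  let ?q = "\<lambda>y t. ((norm (x + t *\<^sub>R y))\<^sup>2 - (norm x)\<^sup>2) / (2 * t)"
  show "((\<lambda>t. ?q (y + z) t) \<longlongrightarrow> rho_plus x (y + z)) (at_right 0)"
    by (rule rho_plus_tendsto)
  have "((\<lambda>t. ?q y (2 * t)) \<longlongrightarrow> rho_plus x y) (at_right 0)" for y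
    by (rule filterlim_compose[OF rho_plus_tendsto filterlim_mult_at_right_0]) simp
  then show "((\<lambda>t. ?q y (2 * t) + ?q z (2 * t)) \<longlongrightarrow> rho_plus x y + rho_plus x z) (at_right 0)"
    by (intro tendsto_add)
  have "?q (y + z) t \<le> ?q y (2 * t) + ?q z (2 * t)" if "0 < t" for t
  proof -
    let ?a = "norm (x + (2 * t) *\<^sub>R y)" and ?b = "norm (x + (2 * t) *\<^sub>R z)"
    have "2 *\<^sub>R (x + t *\<^sub>R (y + z)) = (x + (2 * t) *\<^sub>R y) + (x + (2 * t) *\<^sub>R z)"
      by (simp add: algebra_simps scaleR_2)
    then have "2 * norm (x + t *\<^sub>R (y + z)) \<le> ?a + ?b"
      by (metis norm_triangle_ineq norm_scaleR abs_numeral)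
    then have "(2 * norm (x + t *\<^sub>R (y + z)))\<^sup>2 \<le> (?a + ?b)\<^sup>2"
      by (intro power_mono) auto
    also have "\<dots> \<le> 2 * (?a\<^sup>2 + ?b\<^sup>2)"
      using sum_squares_ge_zero[of "?a - ?b" 0] by (simp add: power2_eq_square algebra_simps)
    finally have "0 \<le> (?a\<^sup>2 + ?b\<^sup>2 - 2 * (norm (x + t *\<^sub>R (y + z)))\<^sup>2) / (4 * t)"
      using that by (simp add: power_mult_distrib)
    also have "\<dots> = ?q y (2 * t) + ?q z (2 * t) - ?q (y + z) t"
      using that by (simp add: field_simps)
    finally show ?thesis by simp
  qed
  then show "\<forall>\<^sub>F t in at_right 0. ?q (y + z) t \<le> ?q y (2 * t) + ?q z (2 * t)"
    by (intro eventually_at_rightI[of 0 1]) auto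
qed simp

lemma rho_plus_zero_right [simp]: "rho_plus x 0 = 0"
  using rho_plus_scaleC_self[of x 0] by simp

lemma rho_plus_scaleR:
  assumes "0 \<le> r" shows "rho_plus x (r *\<^sub>R y) = r * rho_plus x y"
proof (cases "r = 0")
  case False
  with assms have r: "0 < r" by simp
  have "((\<lambda>t. r * (((norm (x + (r * t) *\<^sub>R y))\<^sup>2 - (norm x)\<^sup>2) / (2 * (r * t)))) \<longlongrightarrow> r * rho_plus x y) (at_right 0)"
    by (intro tendsto_mult_left filterlim_compose[OF rho_plus_tendsto filterlim_mult_at_right_0] r)
  with r show ?thesis
    by (intro rho_plus_eqI) (simp add: mult.commute)
qed simp

lemma rho_plus_le_norm: "rho_plus x y \<le> norm x * norm y"
proof -
  have "rho_plus x y \<le> norm x * ((norm (x + 1 *\<^sub>R y) - norm x) / 1)"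
    by (rule rho_plus_le_quotient) simp
  also have "\<dots> \<le> norm x * norm y"
    using norm_triangle_ineq[of x y] by (intro mult_left_mono) auto
  finally show ?thesis .
qed

text \<open>Subadditivity for \<open>y = (y - z) + z\<close> and for the exchanged roles. This is
  the source of the continuity of the integrand in \<open>rho_inf\<close>.\<close>

lemma rho_plus_lipschitz: "\<bar>rho_plus x y - rho_plus x z\<bar> \<le> norm x * norm (y - z)"
  using rho_plus_subadditive[of x "y - z" z] rho_plus_subadditive[of x "z - y" y]
    rho_plus_le_norm[of x "y - z"] rho_plus_le_norm[of x "z - y"]
  by (simp add: norm_minus_commute abs_le_iff)

text \<open>Subadditivity gives one inequality; subtracting \<open>a *\<^sub>C x\<close> again gives
  the other, because the values on multiples of \<open>x\<close> are known exactly and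
  cancel.\<close>

lemma rho_plus_add_scaleC_self: "rho_plus x (a *\<^sub>C x + y) = Re a * (norm x)\<^sup>2 + rho_plus x y"
  using rho_plus_subadditive[of x "a *\<^sub>C x" y] rho_plus_subadditive[of x "(- a) *\<^sub>C x" "a *\<^sub>C x + y"]
  unfolding rho_plus_scaleC_self by (simp add: scaleC_minus_left)

subsection \<open>The averaged norm derivative\<close>

lemma continuous_on_rho_plus_rotation:
  "continuous_on A (\<lambda>\<theta>. rho_plus x (exp (\<i> * complex_of_real \<theta>) *\<^sub>C y))"
  unfolding continuous_on_def
proof
  fix t assume "t \<in> A"
  let ?e = "\<lambda>\<theta>. exp (\<i> * complex_of_real \<theta>)"
  have "((\<lambda>s. norm x * (cmod (?e s - ?e t) * norm y)) \<longlongrightarrow> norm x * (cmod (?e t - ?e t) * norm y)) (at t within A)"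
    by (intro tendsto_intros)
  then have lim: "((\<lambda>s. norm x * (cmod (?e s - ?e t) * norm y)) \<longlongrightarrow> 0) (at t within A)"
    by simp
  have "((\<lambda>s. rho_plus x (?e s *\<^sub>C y) - rho_plus x (?e t *\<^sub>C y)) \<longlongrightarrow> 0) (at t within A)"
    by (rule Lim_null_comparison[OF always_eventually lim])
      (use rho_plus_lipschitz[of x "_ *\<^sub>C y" "_ *\<^sub>C y"] in
        \<open>simp add: scaleC_diff_left[symmetric] norm_scaleC\<close>)
  then show "((\<lambda>s. rho_plus x (?e s *\<^sub>C y)) \<longlongrightarrow> rho_plus x (?e t *\<^sub>C y)) (at t within A)"
    by (simp add: LIM_zero_iff)
qed

text \<open>The integrand is continuous, so the integral exists; later computations of
  \<open>rho_inf\<close> go through \<open>has_integral\<close>.\<close>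

lemma rho_inf_has_integral:
  "((\<lambda>\<theta>. exp (\<i> * complex_of_real \<theta>) * complex_of_real (rho_plus x (exp (\<i> * complex_of_real \<theta>) *\<^sub>C y)))
     has_integral of_real pi * rho_inf x y) {0..2 * pi}"
proof -
  have "(\<lambda>\<theta>. exp (\<i> * complex_of_real \<theta>) * complex_of_real (rho_plus x (exp (\<i> * complex_of_real \<theta>) *\<^sub>C y)))
     integrable_on {0..2 * pi}"
    by (intro integrable_continuous_interval continuous_intros continuous_on_rho_plus_rotation)
  then show ?thesis
    unfolding rho_inf_def by (simp add: has_integral_integral)
qed

lemma rho_inf_eqI:
  assumes "((\<lambda>\<theta>. exp (\<i> * complex_of_real \<theta>) * complex_of_real (rho_plus x (exp (\<i> * complex_of_real \<theta>) *\<^sub>C y)))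
     has_integral of_real pi * I) {0..2 * pi}"
  shows "rho_inf x y = I"
  using has_integral_unique[OF rho_inf_has_integral assms] by simp

text \<open>With \<open>e = exp (\<i> * \<theta>)\<close> the integrand is
  \<open>cnj a / 2 + e * e * a / 2\<close>, and the second term integrates to zero over a full
  period.\<close>

lemma has_integral_exp_times_Re:
  "((\<lambda>\<theta>. exp (\<i> * complex_of_real \<theta>) * complex_of_real (Re (exp (\<i> * complex_of_real \<theta>) * a)))
     has_integral of_real pi * cnj a) {0..2 * pi}"
proof -
  let ?F = "\<lambda>\<theta>. complex_of_real \<theta> * cnj a / 2 + exp (2 * \<i> * complex_of_real \<theta>) * a / (4 * \<i>)"
  have eq: "exp (\<i> * complex_of_real \<theta>) * complex_of_real (Re (exp (\<i> * complex_of_real \<theta>) * a))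
      = cnj a / 2 + exp (2 * \<i> * complex_of_real \<theta>) * (2 * \<i>) * a / (4 * \<i>)" for \<theta>
  proof -
    let ?e = "exp (\<i> * complex_of_real \<theta>)"
    have "2 * complex_of_real (Re (?e * a)) = ?e * a + cnj ?e * cnj a"
      using complex_add_cnj[of "?e * a"] by simp
    moreover have "?e * cnj ?e = 1"
      by (simp add: exp_cnj exp_add[symmetric])
    moreover have "exp (2 * \<i> * complex_of_real \<theta>) = ?e * ?e"
      by (simp add: exp_add[symmetric] mult.assoc)
    ultimately have "?e * (2 * complex_of_real (Re (?e * a))) = exp (2 * \<i> * complex_of_real \<theta>) * a + cnj a"
      by (simp add: algebra_simps)
    then show ?thesis by (simp add: field_simps)
  qed
  have "((\<lambda>\<theta>. cnj a / 2 + exp (2 * \<i> * complex_of_real \<theta>) * (2 * \<i>) * a / (4 * \<i>))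
      has_integral ?F (2 * pi) - ?F 0) {0..2 * pi}"
    by (rule fundamental_theorem_of_calculus) (auto intro!: derivative_eq_intros has_vector_derivative_real_field)
  moreover have "exp (2 * \<i> * complex_of_real (2 * pi)) = 1"
    using exp_two_pi_i exp_add[of "2 * pi * \<i>" "2 * pi * \<i>"] by (simp add: mult_ac)
  ultimately show ?thesis unfolding eq by simp
qed

text \<open>Rotation by \<open>e\<close> turns the coefficient \<open>a\<close> into
  \<open>e * a\<close>, so the extra term is the integral just computed. For
  \<open>x \<noteq> 0\<close>, any \<open>y\<close> can thus be made orthogonal to \<open>x\<close>
  by adding a multiple of \<open>x\<close>.\<close>

lemma rho_inf_add_scaleC_self: "rho_inf x (a *\<^sub>C x + y) = cnj a * of_real ((norm x)\<^sup>2) + rho_inf x y"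
proof (rule rho_inf_eqI)
  let ?e = "\<lambda>\<theta>. exp (\<i> * complex_of_real \<theta>)"
  have "((\<lambda>\<theta>. ?e \<theta> * complex_of_real (Re (?e \<theta> * a)) * of_real ((norm x)\<^sup>2)
        + ?e \<theta> * complex_of_real (rho_plus x (?e \<theta> *\<^sub>C y)))
     has_integral of_real pi * cnj a * of_real ((norm x)\<^sup>2) + of_real pi * rho_inf x y) {0..2 * pi}"
    by (intro has_integral_add has_integral_mult_left has_integral_exp_times_Re rho_inf_has_integral)
  moreover have "rho_plus x (?e \<theta> *\<^sub>C (a *\<^sub>C x + y)) = Re (?e \<theta> * a) * (norm x)\<^sup>2 + rho_plus x (?e \<theta> *\<^sub>C y)" for \<theta>
    by (simp only: scaleC_add_right scaleC_scaleC rho_plus_add_scaleC_self)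
  ultimately show "((\<lambda>\<theta>. ?e \<theta> * complex_of_real (rho_plus x (?e \<theta> *\<^sub>C (a *\<^sub>C x + y))))
     has_integral of_real pi * (cnj a * of_real ((norm x)\<^sup>2) + rho_inf x y)) {0..2 * pi}"
    by (simp only: of_real_add of_real_mult distrib_left mult.assoc)
qed

lemma rho_inf_zero_right [simp]: "rho_inf x 0 = 0"
  by (rule rho_inf_eqI) simp

lemma rho_inf_scaleC_self: "rho_inf x (a *\<^sub>C x) = cnj a * of_real ((norm x)\<^sup>2)"
  using rho_inf_add_scaleC_self[of x a 0] by simp

lemma rho_inf_self: "rho_inf x x = of_real ((norm x)\<^sup>2)"
  using rho_inf_scaleC_self[of x 1] by (simp add: scaleC_one)

section \<open>Reflected integrals and bounds for the real part of \<open>rho_inf\<close>\<close>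

lemma has_integral_reflect_midpoint:
  fixes f :: "real \<Rightarrow> 'b::real_normed_vector"
  assumes "(f has_integral I) {a..b}"
  shows "((\<lambda>t. f (a + b - t)) has_integral I) {a..b}"
proof -
  have "(\<lambda>x. (1 / (- 1)) *\<^sub>R x + - ((1 / (- 1)) *\<^sub>R (a + b))) ` cbox a b = {a..b}"
    by (auto simp: image_iff intro!: bexI[of _ "a + b - _"])
  with has_integral_affinity[of f I a b "- 1" "a + b"] assms show ?thesis
    by (simp add: algebra_simps)
qed

text \<open>The map \<open>pi - t\<close> carries \<open>{0..pi}\<close> onto itself. On
  \<open>{pi..2 * pi}\<close> the reflection is \<open>3 * pi - t\<close>, which differs from it by
  one period.\<close>

lemma has_integral_periodic_reflect:
  fixes f :: "real \<Rightarrow> real"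
  assumes f: "(f has_integral I) {0..2 * pi}" and per: "\<And>t. f (t + 2 * pi) = f t"
  shows "((\<lambda>t. f (pi - t)) has_integral I) {0..2 * pi}"
proof -
  have i: "f integrable_on {0..pi}" "f integrable_on {pi..2 * pi}"
    using f by (auto intro: integrable_subinterval_real[of f 0 "2 * pi"])
  then obtain A B where A: "(f has_integral A) {0..pi}" and B: "(f has_integral B) {pi..2 * pi}"
    by (auto simp: integrable_on_def)
  have "I = A + B"
    using has_integral_combine[OF _ _ A B] has_integral_unique[OF f] by simp
  moreover have "f (pi + 2 * pi - t) = f (pi - t)" for t
    using per[of "pi - t"] by (simp add: algebra_simps)
  ultimately show ?thesis
    using has_integral_combine[OF _ _ has_integral_reflect_midpoint[OF A] , of "2 * pi" B]
      has_integral_reflect_midpoint[OF B] by simp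
qed

text \<open>The points \<open>exp (\<i> * \<theta>)\<close> and \<open>exp (\<i> * (pi - \<theta>))\<close> differ by the real number \<open>2 * cos \<theta>\<close>; pairing
  them in the integral leaves only \<open>rho_plus x y\<close> and \<open>rho_plus x (- y)\<close>.\<close>

lemma Re_rho_inf_bounds:
  shows Re_rho_inf_le: "Re (rho_inf x y) \<le> rho_plus x y"
    and Re_rho_inf_ge: "- rho_plus x (- y) \<le> Re (rho_inf x y)"
proof -
  define h where "h \<theta> = rho_plus x (exp (\<i> * complex_of_real \<theta>) *\<^sub>C y)" for \<theta>
  have step: "rho_plus x u \<le> rho_plus x (u - c *\<^sub>R z) + c * rho_plus x z" if "0 \<le> c" for u c z
    using rho_plus_subadditive[of x "u - c *\<^sub>R z" "c *\<^sub>R z"] rho_plus_scaleR[OF that, of x z] by simp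
  have refl: "exp (\<i> * complex_of_real (pi - \<theta>)) *\<^sub>C y
      = exp (\<i> * complex_of_real \<theta>) *\<^sub>C y - (2 * cos \<theta>) *\<^sub>R y" for \<theta>
  proof -
    have "exp (\<i> * complex_of_real (pi - \<theta>)) = exp (\<i> * complex_of_real \<theta>) - of_real (2 * cos \<theta>)"
      by (simp add: complex_eq_iff Re_exp Im_exp)
    then show ?thesis by (simp only: scaleC_diff_left scaleC_of_real)
  qed
  have up: "cos \<theta> * h \<theta> + cos (pi - \<theta>) * h (pi - \<theta>) \<le> 2 * (cos \<theta>)\<^sup>2 * rho_plus x y"
    and lo: "2 * (cos \<theta>)\<^sup>2 * - rho_plus x (- y) \<le> cos \<theta> * h \<theta> + cos (pi - \<theta>) * h (pi - \<theta>)" for \<theta>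
  proof -
    let ?u = "exp (\<i> * complex_of_real \<theta>) *\<^sub>C y" and ?v = "exp (\<i> * complex_of_real (pi - \<theta>)) *\<^sub>C y"
    \<comment> \<open>Since \<open>cos (pi - \<theta>) = - cos \<theta>\<close>, the paired
      integrand is \<open>cos \<theta> * (h \<theta> - h (pi - \<theta>))\<close>. Bounding both
      orders of the difference covers both signs of the cosine.\<close>
    have "\<bar>cos \<theta>\<bar> * (h \<theta> - h (pi - \<theta>)) \<le> \<bar>cos \<theta>\<bar> * (2 * \<bar>cos \<theta>\<bar> * (if 0 \<le> cos \<theta> then rho_plus x y else rho_plus x (- y)))"
      using step[of "2 * cos \<theta>" ?u y] step[of "- 2 * cos \<theta>" ?u "- y"]
      by (intro mult_left_mono) (auto simp: h_def refl simp del: of_real_diff)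
    moreover have "\<bar>cos \<theta>\<bar> * (h (pi - \<theta>) - h \<theta>) \<le> \<bar>cos \<theta>\<bar> * (2 * \<bar>cos \<theta>\<bar> * (if 0 \<le> cos \<theta> then rho_plus x (- y) else rho_plus x y))"
      using step[of "- 2 * cos \<theta>" ?v y] step[of "2 * cos \<theta>" ?v "- y"]
      by (intro mult_left_mono) (auto simp: h_def refl simp del: of_real_diff)
    ultimately show "cos \<theta> * h \<theta> + cos (pi - \<theta>) * h (pi - \<theta>) \<le> 2 * (cos \<theta>)\<^sup>2 * rho_plus x y"
      "2 * (cos \<theta>)\<^sup>2 * - rho_plus x (- y) \<le> cos \<theta> * h \<theta> + cos (pi - \<theta>) * h (pi - \<theta>)"
      by (auto simp: power2_eq_square algebra_simps split: if_splits)
  qed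
  have "((\<lambda>\<theta>. cos \<theta> * h \<theta>) has_integral pi * Re (rho_inf x y)) {0..2 * pi}"
    using has_integral_Re[OF rho_inf_has_integral[of x y]] by (simp add: h_def Re_exp)
  moreover from this have "((\<lambda>\<theta>. cos (pi - \<theta>) * h (pi - \<theta>)) has_integral pi * Re (rho_inf x y)) {0..2 * pi}"
    by (rule has_integral_periodic_reflect) (simp add: h_def distrib_left exp_add mult.commute[of \<i>])
  ultimately have I: "((\<lambda>\<theta>. cos \<theta> * h \<theta> + cos (pi - \<theta>) * h (pi - \<theta>))
      has_integral pi * Re (rho_inf x y) + pi * Re (rho_inf x y)) {0..2 * pi}"
    by (rule has_integral_add)
  \<comment> \<open>The weight \<open>2 * (cos \<theta>)\<^sup>2\<close> has integral
    \<open>2 * pi\<close>, matching the doubled integral in \<open>I\<close>.\<close>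
  have "((\<lambda>\<theta>. (cos \<theta>)\<^sup>2) has_integral pi) {0..2 * pi}"
    using has_integral_Re[OF has_integral_exp_times_Re[of 1]] by (simp add: Re_exp power2_eq_square)
  then have J: "((\<lambda>\<theta>. 2 * (cos \<theta>)\<^sup>2 * c) has_integral 2 * pi * c) {0..2 * pi}" for c
    by (intro has_integral_mult_left has_integral_mult_right)
  show "Re (rho_inf x y) \<le> rho_plus x y"
    using has_integral_le[OF I J up] by simp
  show "- rho_plus x (- y) \<le> Re (rho_inf x y)"
  proof -
    have "2 * pi * - rho_plus x (- y) \<le> 2 * pi * Re (rho_inf x y)"
      using has_integral_le[OF J I lo] by simp
    then show ?thesis by (rule mult_left_le_imp_le) simp
  qed
qed

subsection \<open>Orthogonality preserving maps are similarities\<close>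

text \<open>A convex function lies above its one-sided tangents. For \<open>t > 0\<close> the upper
  bound on \<open>Re (rho_inf x y)\<close> is used, for \<open>t < 0\<close> the lower bound with
  \<open>- y\<close>, so one slope \<open>p\<close> serves on both sides.\<close>

lemma rho_plus_subgradient:
  assumes "x \<noteq> 0" "norm x * p = Re (rho_inf x y)"
  shows "norm x + t * p \<le> norm (x + t *\<^sub>R y)"
proof -
  have pos: "norm x + t * p \<le> norm (x + t *\<^sub>R z)" if "0 < t" "norm x * p \<le> rho_plus x z" for t p z
  proof -
    have "norm x * p \<le> norm x * ((norm (x + t *\<^sub>R z) - norm x) / t)"
      using rho_plus_le_quotient[OF that(1), of x z] that(2) by linarith
    then have "norm x * (norm x + t * p) \<le> norm x * norm (x + t *\<^sub>R z)"
      using that(1) by (simp add: field_simps)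
    then show ?thesis
      by (rule mult_left_le_imp_le) (use assms(1) in simp)
  qed
  consider "t = 0" | "0 < t" | "0 < - t" by linarith
  then show ?thesis
  proof cases
    case 2
    then show ?thesis using pos[of t p y] assms(2) Re_rho_inf_le[of x y] by simp
  next
    case 3
    then show ?thesis using pos[of "- t" "- p" "- y"] assms(2) Re_rho_inf_ge[of x y] by simp
  qed simp
qed

text \<open>Only a common selection \<open>q\<close> of logarithmic subgradients is needed, not its continuity: the
  first-order terms of the increments of \<open>ln (M / m)\<close> telescope along equidistant partitions.\<close>

lemma equal_log_subgradient_quotient_mono:
  fixes m M q :: "real \<Rightarrow> real"
  assumes pos: "\<And>t. t \<in> {0..1} \<Longrightarrow> 0 < m t" "\<And>t. t \<in> {0..1} \<Longrightarrow> 0 < M t"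
    and bound: "\<And>t. t \<in> {0..1} \<Longrightarrow> \<bar>q t\<bar> \<le> C"
    and m: "\<And>s t. s \<in> {0..1} \<Longrightarrow> t \<in> {0..1} \<Longrightarrow> m t * (1 + q t * (s - t)) \<le> m s"
    and M: "\<And>s t. s \<in> {0..1} \<Longrightarrow> t \<in> {0..1} \<Longrightarrow> M t * (1 + q t * (s - t)) \<le> M s"
  shows "M 0 / m 0 \<le> M 1 / m 1"
proof -
  define L where "L t = ln (M t) - ln (m t)" for t
  \<comment> \<open>The bound \<open>ln (1 + u) \<ge> u - 2 * u\<^sup>2\<close> for
    \<open>\<bar>u\<bar> \<le> 1 / 2\<close>, taken at \<open>u = q t * (s - t)\<close>.\<close>
  have ln_step: "q t * (s - t) - 2 * C\<^sup>2 * (s - t)\<^sup>2 \<le> ln (f s) - ln (f t)"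
    if st: "s \<in> {0..1}" "t \<in> {0..1}" and small: "C * \<bar>s - t\<bar> \<le> 1 / 2"
      and f: "0 < f t" "f t * (1 + q t * (s - t)) \<le> f s" for f s t
  proof -
    have "\<bar>q t * (s - t)\<bar> \<le> C * \<bar>s - t\<bar>"
      using bound[OF st(2)] by (simp add: abs_mult mult_right_mono)
    then have u: "\<bar>q t * (s - t)\<bar> \<le> 1 / 2" and "(q t * (s - t))\<^sup>2 \<le> C\<^sup>2 * (s - t)\<^sup>2"
      using small power_mono[of "\<bar>q t * (s - t)\<bar>" "C * \<bar>s - t\<bar>" 2] by (auto simp: power_mult_distrib)
    then have "q t * (s - t) - 2 * C\<^sup>2 * (s - t)\<^sup>2 \<le> ln (1 + q t * (s - t))"
      using abs_ln_one_plus_x_minus_x_bound[OF u] by simp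
    also have "\<dots> = ln (f t * (1 + q t * (s - t))) - ln (f t)"
      using u f(1) by (simp add: ln_mult abs_le_iff)
    also have "\<dots> \<le> ln (f s) - ln (f t)"
    proof -
      have "0 < f t * (1 + q t * (s - t))" using u f(1) by (auto intro!: mult_pos_pos)
      then show ?thesis using f(2) by simp
    qed
    finally show ?thesis .
  qed
  \<comment> \<open>Cut \<open>{0..1}\<close> into \<open>n\<close> equal pieces. The condition
    \<open>2 * C \<le> real n\<close> makes each piece short enough for \<open>ln_step\<close>; the
    quadratic errors \<open>4 * C\<^sup>2 / n\<^sup>2\<close> per piece sum to
    \<open>4 * C\<^sup>2 / n\<close>.\<close>
  have L_ge: "(q 0 - q 1 - 4 * C\<^sup>2) * (1 / real n) \<le> L 1 - L 0" if n: "0 < n" "2 * C \<le> real n" for n :: nat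
  proof -
    define \<tau> where "\<tau> i = real i / real n" for i
    have "(q (\<tau> i) - q (\<tau> (Suc i)) - 4 * C\<^sup>2 / real n) / real n \<le> L (\<tau> (Suc i)) - L (\<tau> i)" if "i < n" for i
    proof -
      have \<tau>: "\<tau> i \<in> {0..1}" "\<tau> (Suc i) \<in> {0..1}" and d: "\<tau> (Suc i) - \<tau> i = 1 / real n"
        using that n by (auto simp: \<tau>_def field_simps)
      have small: "C * \<bar>\<tau> (Suc i) - \<tau> i\<bar> \<le> 1 / 2" "C * \<bar>\<tau> i - \<tau> (Suc i)\<bar> \<le> 1 / 2"
        using n by (simp_all add: d abs_minus_commute[of "\<tau> i"] field_simps)
      \<comment> \<open>\<open>M\<close> is expanded forwards from the left endpoint and
        \<open>m\<close> backwards from the right one, so both estimates bound the increment of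
        \<open>L\<close> from below.\<close>
      have "q (\<tau> i) * (1 / real n) - 2 * C\<^sup>2 * (1 / real n)\<^sup>2 \<le> ln (M (\<tau> (Suc i))) - ln (M (\<tau> i))"
        using ln_step[OF \<tau>(2,1) small(1) pos(2)[OF \<tau>(1)] M[OF \<tau>(2,1)]] unfolding d .
      moreover have "q (\<tau> (Suc i)) * - (1 / real n) - 2 * C\<^sup>2 * (1 / real n)\<^sup>2 \<le> ln (m (\<tau> i)) - ln (m (\<tau> (Suc i)))"
        using ln_step[OF \<tau> small(2) pos(1)[OF \<tau>(2)] m[OF \<tau>]]
        unfolding minus_diff_eq[of "\<tau> (Suc i)" "\<tau> i", symmetric] d power2_minus .
      moreover have "(q (\<tau> i) - q (\<tau> (Suc i)) - 4 * C\<^sup>2 / real n) / real n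
          = (q (\<tau> i) * (1 / real n) - 2 * C\<^sup>2 * (1 / real n)\<^sup>2)
            + (q (\<tau> (Suc i)) * - (1 / real n) - 2 * C\<^sup>2 * (1 / real n)\<^sup>2)"
        using n by (simp add: field_simps power2_eq_square)
      ultimately show ?thesis
        by (simp add: L_def)
    qed
    then have "(\<Sum>i<n. (q (\<tau> i) - q (\<tau> (Suc i)) - 4 * C\<^sup>2 / real n) / real n) \<le> (\<Sum>i<n. L (\<tau> (Suc i)) - L (\<tau> i))"
      by (intro sum_mono) auto
    moreover have "(\<Sum>i<n. L (\<tau> (Suc i)) - L (\<tau> i)) = L 1 - L 0"
      using n sum_lessThan_telescope[of "\<lambda>i. L (\<tau> i)" n] by (simp add: \<tau>_def)
    moreover have "(\<Sum>i<n. (q (\<tau> i) - q (\<tau> (Suc i)) - 4 * C\<^sup>2 / real n) / real n) = (q 0 - q 1 - 4 * C\<^sup>2) * (1 / real n)"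
    proof -
      have "(\<Sum>i<n. q (\<tau> i) - q (\<tau> (Suc i))) = q 0 - q 1"
        using n sum_lessThan_telescope'[of "\<lambda>i. q (\<tau> i)" n] by (simp add: \<tau>_def)
      then show ?thesis
        using n by (simp add: sum_subtractf flip: sum_divide_distrib)
    qed
    ultimately show ?thesis by simp
  qed
  have "(\<lambda>n. (q 0 - q 1 - 4 * C\<^sup>2) * (1 / real n)) \<longlonglongrightarrow> (q 0 - q 1 - 4 * C\<^sup>2) * 0"
    by (intro tendsto_mult_left lim_1_over_n)
  then have "(q 0 - q 1 - 4 * C\<^sup>2) * 0 \<le> L 1 - L 0"
    by (rule tendsto_upperbound)
      (use L_ge in \<open>auto intro!: eventually_sequentiallyI[of "nat \<lceil>max 1 (2 * C)\<rceil>"] simp: nat_ceiling_le_eq\<close>)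
  then have "ln (M 0 / m 0) \<le> ln (M 1 / m 1)"
    using pos[of 0] pos[of 1] by (simp add: L_def ln_div)
  then show ?thesis
    using pos[of 0] pos[of 1] by (simp add: ln_le_cancel_iff)
qed

text \<open>The hypotheses are symmetric in \<open>m\<close> and \<open>M\<close>, so exchanging
  them reverses the inequality.\<close>

lemma equal_log_subgradient_quotient:
  fixes m M q :: "real \<Rightarrow> real"
  assumes "\<And>t. t \<in> {0..1} \<Longrightarrow> 0 < m t" "\<And>t. t \<in> {0..1} \<Longrightarrow> 0 < M t"
    and "\<And>t. t \<in> {0..1} \<Longrightarrow> \<bar>q t\<bar> \<le> C"
    and "\<And>s t. s \<in> {0..1} \<Longrightarrow> t \<in> {0..1} \<Longrightarrow> m t * (1 + q t * (s - t)) \<le> m s"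
    and "\<And>s t. s \<in> {0..1} \<Longrightarrow> t \<in> {0..1} \<Longrightarrow> M t * (1 + q t * (s - t)) \<le> M s"
  shows "M 0 / m 0 = M 1 / m 1"
proof (rule antisym)
  show "M 0 / m 0 \<le> M 1 / m 1"
    by (rule equal_log_subgradient_quotient_mono[of m M q C]) (use assms in auto)
  have "m 0 / M 0 \<le> m 1 / M 1"
    by (rule equal_log_subgradient_quotient_mono[of M m q C]) (use assms in auto)
  then show "M 1 / m 1 \<le> M 0 / m 0"
    using assms(1)[of 0] assms(1)[of 1] assms(2)[of 0] assms(2)[of 1] by (simp add: field_simps)
qed

section \<open>Rigidity of complex-linear maps preserving orthogonality\<close>

context bounded_clinear
begin

lemma rho_inf_eq_of_preserves:
  assumes "preserves_rho_inf_orthogonality T"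
  shows "of_real ((norm x)\<^sup>2) * rho_inf (T x) (T y) = of_real ((norm (T x))\<^sup>2) * rho_inf x y"
proof (cases "x = 0")
  case False
  \<comment> \<open>The solution of \<open>cnj a * (norm x)\<^sup>2 + rho_inf x y = 0\<close>, which
    makes \<open>a *\<^sub>C x + y\<close> orthogonal to \<open>x\<close>.\<close>
  define a where "a = - cnj (rho_inf x y) / of_real ((norm x)\<^sup>2)"
  have "rho_inf x (a *\<^sub>C x + y) = 0"
    using False by (simp add: rho_inf_add_scaleC_self a_def)
  then have "rho_inf (T x) (a *\<^sub>C T x + T y) = 0"
    using assms by (metis preserves_rho_inf_orthogonality_def add scaleC)
  then have "cnj a * of_real ((norm (T x))\<^sup>2) + rho_inf (T x) (T y) = 0"
    by (simp add: rho_inf_add_scaleC_self)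
  moreover have "of_real ((norm x)\<^sup>2) * cnj a = - rho_inf x y"
    using False by (simp add: a_def)
  moreover have "rho_inf (T x) (T y) = - (cnj a * of_real ((norm (T x))\<^sup>2))"
    using calculation(1) add_eq_0_iff by blast
  ultimately show ?thesis
    by (metis minus_mult_left mult.assoc mult.commute mult_minus_right minus_minus)
qed (simp add: zero)

text \<open>If \<open>T x = 0\<close> and \<open>T y \<noteq> 0\<close>, then \<open>T\<close> sends
  \<open>z = x + t y\<close> to \<open>t T y\<close>, so \<open>rho_inf (T z) (T y)\<close> is
  explicit. Pulled back, \<open>rho_inf z y = (norm z)\<^sup>2 / t\<close>, and the bound
  \<open>norm z * norm y\<close> gives \<open>norm z \<le> t * norm y\<close>. Letting
  \<open>t\<close> tend to 0 gives \<open>x = 0\<close>.\<close>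

lemma kernel_trivial_of_preserves:
  assumes T: "preserves_rho_inf_orthogonality T" and "T \<noteq> (\<lambda>x. 0)" and x: "T x = 0"
  shows "x = 0"
proof -
  obtain y where y: "T y \<noteq> 0" using assms(2) by auto
  have le: "norm (x + t *\<^sub>R y) \<le> t * norm y" if t: "0 < t" for t
  proof (cases "x + t *\<^sub>R y = 0")
    case False
    let ?z = "x + t *\<^sub>R y"
    have Tz: "T ?z = t *\<^sub>R T y" by (simp add: add scaleR x)
    have "rho_inf (T ?z) (T y) = rho_inf (T ?z) (of_real (1 / t) *\<^sub>C T ?z)"
      using t by (simp add: Tz scaleC_of_real del: of_real_divide)
    also have "\<dots> = of_real (1 / t * (norm (T ?z))\<^sup>2)"
      unfolding rho_inf_scaleC_self by simp
    finally have "of_real ((norm ?z)\<^sup>2) * complex_of_real (1 / t * (norm (T ?z))\<^sup>2) = of_real ((norm (T ?z))\<^sup>2) * rho_inf ?z y"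
      using rho_inf_eq_of_preserves[OF T, of ?z y] by simp
    then have "of_real ((norm (T ?z))\<^sup>2) * complex_of_real ((norm ?z)\<^sup>2 / t) = of_real ((norm (T ?z))\<^sup>2) * rho_inf ?z y"
      by (simp add: mult_ac)
    moreover have "norm (T ?z) \<noteq> 0"
      using y t by (simp add: Tz)
    ultimately have "complex_of_real ((norm ?z)\<^sup>2 / t) = rho_inf ?z y"
      by (simp only: mult_left_cancel of_real_eq_0_iff power_eq_0_iff simp_thms)
    then have "(norm ?z)\<^sup>2 / t = Re (rho_inf ?z y)"
      by (metis Re_complex_of_real)
    also have "\<dots> \<le> norm ?z * norm y"
      using Re_rho_inf_le[of ?z y] rho_plus_le_norm[of ?z y] by linarith
    finally show ?thesis
      using t False by (simp add: field_simps power2_eq_square)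
  qed (use t in simp)
  have lim: "((\<lambda>t. norm (x + t *\<^sub>R y)) \<longlongrightarrow> norm (x + 0 *\<^sub>R y)) (at_right 0)"
    "((\<lambda>t. t * norm y) \<longlongrightarrow> 0 * norm y) (at_right 0)"
    by (intro tendsto_intros)+
  have "norm (x + 0 *\<^sub>R y) \<le> 0 * norm y"
    by (rule tendsto_le[OF _ lim(2) lim(1)]) (auto intro!: eventually_at_rightI[of 0 1] le)
  then show ?thesis by simp
qed

lemma norm_quotient_eq_of_preserves:
  assumes T: "preserves_rho_inf_orthogonality T" and nz: "T \<noteq> (\<lambda>x. 0)"
    and seg: "\<And>t. t \<in> {0..1} \<Longrightarrow> x + t *\<^sub>R v \<noteq> 0"
  shows "norm (T x) / norm x = norm (T (x + v)) / norm (x + v)"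
proof -
  define z where "z t = x + t *\<^sub>R v" for t
  define q where "q t = Re (rho_inf (z t) v) / (norm (z t))\<^sup>2" for t
  have z: "z t \<noteq> 0" "T (z t) \<noteq> 0" if "t \<in> {0..1}" for t
    using seg[OF that] kernel_trivial_of_preserves[OF T nz] by (auto simp: z_def)
  have zst: "z s = z t + (s - t) *\<^sub>R v" for s t
    by (simp add: z_def algebra_simps)
  \<comment> \<open>The same \<open>q\<close> is a logarithmic subgradient along the image segment;
    dividing is allowed because the kernel is trivial.\<close>
  have Tq: "q t = Re (rho_inf (T (z t)) (T v)) / (norm (T (z t)))\<^sup>2" if "t \<in> {0..1}" for t
  proof -
    have "Re (of_real ((norm (z t))\<^sup>2) * rho_inf (T (z t)) (T v)) = Re (of_real ((norm (T (z t)))\<^sup>2) * rho_inf (z t) v)"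
      by (simp only: rho_inf_eq_of_preserves[OF T])
    then show ?thesis
      using z[OF that] by (simp add: q_def field_simps)
  qed
  \<comment> \<open>The norm attains a positive minimum on the segment, which yields the uniform
    bound on \<open>q\<close>.\<close>
  have "continuous_on {0..1} (\<lambda>t. norm (z t))"
    unfolding z_def by (intro continuous_intros)
  then obtain t0 where t0: "t0 \<in> {0..1}" and min: "\<And>t. t \<in> {0..1} \<Longrightarrow> norm (z t0) \<le> norm (z t)"
    using continuous_attains_inf[of "{0..1::real}" "\<lambda>t. norm (z t)"] by auto
  have "norm (T (z 0)) / norm (z 0) = norm (T (z 1)) / norm (z 1)"
  proof (rule equal_log_subgradient_quotient[where C = "norm v / norm (z t0)" and q = q])
    fix t :: real assume t: "t \<in> {0..1}"
    show "0 < norm (z t)" "0 < norm (T (z t))" using z[OF t] by auto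
    have "\<bar>Re (rho_inf (z t) v)\<bar> \<le> norm (z t) * norm v"
      using Re_rho_inf_le[of "z t" v] Re_rho_inf_ge[of "z t" v]
        rho_plus_le_norm[of "z t" v] rho_plus_le_norm[of "z t" "- v"] by simp
    then have "\<bar>q t\<bar> \<le> norm v / norm (z t)"
      using z[OF t] by (simp add: q_def abs_divide field_simps power2_eq_square)
    also have "\<dots> \<le> norm v / norm (z t0)"
      using z[OF t0] min[OF t] by (intro divide_left_mono mult_pos_pos) auto
    finally show "\<bar>q t\<bar> \<le> norm v / norm (z t0)" .
    fix s :: real
    have "norm (z t) + (s - t) * (norm (z t) * q t) \<le> norm (z t + (s - t) *\<^sub>R v)"
      using z[OF t] by (intro rho_plus_subgradient) (auto simp: q_def power2_eq_square)
    then show "norm (z t) * (1 + q t * (s - t)) \<le> norm (z s)"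
      by (simp add: zst[of s t] algebra_simps)
    have "norm (T (z t)) + (s - t) * (norm (T (z t)) * q t) \<le> norm (T (z t) + (s - t) *\<^sub>R T v)"
      using z[OF t] by (intro rho_plus_subgradient) (auto simp: Tq[OF t] power2_eq_square)
    also have "T (z t) + (s - t) *\<^sub>R T v = T (z s)"
      by (simp add: zst[of s t] add scaleR)
    finally show "norm (T (z t)) * (1 + q t * (s - t)) \<le> norm (T (z s))"
      by (simp add: algebra_simps)
  qed
  then show ?thesis by (simp add: z_def)
qed

lemma norm_eq_onormI:
  assumes "\<And>x. norm (T x) = c * norm x" "0 \<le> c"
  shows "norm (T x) = onorm T * norm x"
proof (cases "\<exists>z :: 'a. z \<noteq> 0")
  case True
  then obtain z :: 'a where z: "z \<noteq> 0" by blast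
  have "onorm T \<le> c" using assms by (intro onorm_bound) auto
  moreover have "c * norm z \<le> onorm T * norm z"
    using onorm[OF bounded_linear_axioms, of z] assms(1) by simp
  ultimately have "onorm T = c" using z by simp
  then show ?thesis by (simp add: assms(1))
next
  \<comment> \<open>On the zero space \<open>onorm T\<close> need not equal \<open>c\<close>, but
    both sides vanish.\<close>
  case False
  then have "x = 0" by blast
  then show ?thesis by (simp add: zero)
qed

text \<open>Compare every \<open>y\<close> with a fixed \<open>x0\<close> along the segment joining
  them. If that segment meets 0, then \<open>y\<close> is a real multiple of \<open>x0\<close> and
  homogeneity suffices.\<close>

lemma similarity_of_preserves:
  assumes T: "preserves_rho_inf_orthogonality T" and nz: "T \<noteq> (\<lambda>x. 0)"
  shows "norm (T x) = onorm T * norm x"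
proof -
  obtain x0 where "T x0 \<noteq> 0" using nz by auto
  then have x0: "x0 \<noteq> 0" using zero by auto
  have "norm (T y) = norm (T x0) / norm x0 * norm y" for y
  proof (cases "y = 0")
    case y: False
    show ?thesis
    proof (cases "\<exists>t\<in>{0..1}. x0 + t *\<^sub>R (y - x0) = 0")
      case False
      then have "norm (T x0) / norm x0 = norm (T y) / norm y"
        using norm_quotient_eq_of_preserves[OF T nz, of x0 "y - x0"] by auto
      then show ?thesis using y by simp
    next
      case True
      then obtain t where "x0 + t *\<^sub>R (y - x0) = 0" by blast
      then have eq: "t *\<^sub>R y = (t - 1) *\<^sub>R x0" by (simp add: algebra_simps add_eq_0_iff2)
      with x0 have t: "t \<noteq> 0" by auto
      then have "y = ((t - 1) / t) *\<^sub>R x0"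
        using arg_cong[OF eq, of "\<lambda>u. (1 / t) *\<^sub>R u"] by simp
      then show ?thesis using x0 by (simp add: scaleR)
    qed
  qed (simp add: zero)
  then show ?thesis by (rule norm_eq_onormI) simp
qed

lemma rho_inf_similarity:
  assumes "\<And>x. norm (T x) = c * norm x"
  shows "rho_inf (T x) (T y) = of_real (c\<^sup>2) * rho_inf x y"
proof -
  have plus: "rho_plus (T x) (T y) = c\<^sup>2 * rho_plus x y" for x y
  proof (rule rho_plus_eqI)
    have "((norm (T x + t *\<^sub>R T y))\<^sup>2 - (norm (T x))\<^sup>2) / (2 * t) = c\<^sup>2 * (((norm (x + t *\<^sub>R y))\<^sup>2 - (norm x)\<^sup>2) / (2 * t))" for t
      using assms[of x] assms[of "x + t *\<^sub>R y"]
      by (simp add: add scaleR power_mult_distrib right_diff_distrib)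
    then show "((\<lambda>t. ((norm (T x + t *\<^sub>R T y))\<^sup>2 - (norm (T x))\<^sup>2) / (2 * t)) \<longlongrightarrow> c\<^sup>2 * rho_plus x y) (at_right 0)"
      using tendsto_mult_left[OF rho_plus_tendsto, of "c\<^sup>2" x y] by (simp only:)
  qed
  show ?thesis
  proof (rule rho_inf_eqI)
    let ?e = "\<lambda>\<theta>. exp (\<i> * complex_of_real \<theta>)"
    have "rho_plus (T x) (?e \<theta> *\<^sub>C T y) = c\<^sup>2 * rho_plus x (?e \<theta> *\<^sub>C y)" for \<theta>
      by (simp flip: scaleC add: plus)
    then show "((\<lambda>\<theta>. ?e \<theta> * complex_of_real (rho_plus (T x) (?e \<theta> *\<^sub>C T y))) has_integral
        of_real pi * (of_real (c\<^sup>2) * rho_inf x y)) {0..2 * pi}"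
      using has_integral_mult_right[OF rho_inf_has_integral, of "of_real (c\<^sup>2)" x y] by (simp add: mult_ac)
  qed
qed

theorem rho_inf_equivalences:
  assumes nz: "T \<noteq> (\<lambda>x. 0)"
  shows "preserves_rho_inf_orthogonality T \<longleftrightarrow> (\<forall>x. norm (T x) = onorm T * norm x)" (is ?A)
    and "(\<forall>x. norm (T x) = onorm T * norm x) \<longleftrightarrow>
      (\<forall>x y. rho_inf (T x) (T y) = complex_of_real ((onorm T)\<^sup>2) * rho_inf x y)" (is ?B)
proof -
  show ?A
    using similarity_of_preserves[OF _ nz] rho_inf_similarity[of "onorm T"]
    by (auto simp: preserves_rho_inf_orthogonality_def)
  \<comment> \<open>The diagonal \<open>y = x\<close> recovers the norm from
    \<open>rho_inf\<close>.\<close>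
  have "norm (T x) = onorm T * norm x"
    if "rho_inf (T x) (T x) = complex_of_real ((onorm T)\<^sup>2) * rho_inf x x" for x
  proof -
    have "(norm (T x))\<^sup>2 = (onorm T * norm x)\<^sup>2"
      using that unfolding rho_inf_self
      by (metis of_real_eq_iff of_real_mult power_mult_distrib)
    then show ?thesis
      using onorm_pos_le[OF bounded_linear_axioms] by simp
  qed
  then show ?B
    using rho_inf_similarity[of "onorm T"] by auto
qed

end

subsection \<open>Existence of semi-inner products\<close>

definition sublinear :: "('a::real_vector \<Rightarrow> real) \<Rightarrow> bool" where
  "sublinear p \<longleftrightarrow> (\<forall>x y. p (x + y) \<le> p x + p y) \<and> (\<forall>r x. 0 < r \<longrightarrow> p (r *\<^sub>R x) \<le> r * p x)"

lemma sublinearI: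
  assumes "\<And>x y. p (x + y) \<le> p x + p y" "\<And>r x. 0 < r \<Longrightarrow> p (r *\<^sub>R x) \<le> r * p x"
  shows "sublinear p"
  using assms by (auto simp: sublinear_def)

context
  fixes p :: "'a::real_vector \<Rightarrow> real"
  assumes p: "sublinear p"
begin

lemma sublinear_add_le: "p (x + y) \<le> p x + p y"
  using p by (simp add: sublinear_def)

lemma sublinear_zero: "p 0 = 0"
proof -
  \<comment> \<open>The factor 1/2 forces \<open>p 0 \<le> 0\<close>, the factor 2 forces
    \<open>0 \<le> p 0\<close>.\<close>
  have "p ((1 / 2) *\<^sub>R 0) \<le> 1 / 2 * p 0" "p (2 *\<^sub>R 0) \<le> 2 * p 0"
    using p unfolding sublinear_def by (meson half_gt_zero zero_less_one zero_less_numeral)+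
  then show ?thesis by simp
qed

lemma sublinear_scaleR:
  assumes "0 \<le> r" shows "p (r *\<^sub>R x) = r * p x"
proof (cases "r = 0")
  case False
  then have r: "0 < r" using assms by simp
  have "p ((1 / r) *\<^sub>R (r *\<^sub>R x)) \<le> 1 / r * p (r *\<^sub>R x)"
    using p r by (simp only: sublinear_def zero_less_divide_1_iff)
  moreover have "p (r *\<^sub>R x) \<le> r * p x"
    using p r by (simp only: sublinear_def)
  ultimately show ?thesis using r by (simp add: field_simps)
qed (simp add: sublinear_zero)

lemma sublinear_minus_le: "- p (- x) \<le> p x"
  using sublinear_add_le[of x "- x"] by (simp add: sublinear_zero)

end

text \<open>For a direction \<open>v\<close>, the infimum over \<open>t \<ge> 0\<close> of
  \<open>p (y + t v) - t * p v\<close> is sublinear and below \<open>p\<close>, hence equal to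
  \<open>p\<close>. Its term at \<open>t = 1\<close> yields superadditivity.\<close>

lemma minimal_sublinear_linear:
  fixes p :: "'a::real_vector \<Rightarrow> real"
  assumes p: "sublinear p" and min: "\<And>q. sublinear q \<Longrightarrow> (\<And>x. q x \<le> p x) \<Longrightarrow> q = p"
  shows "linear p"
proof -
  have super: "p x + p v \<le> p (x + v)" for x v
  proof -
    define g where "g y t = p (y + t *\<^sub>R v) - t * p v" for y t
    define q where "q y = (INF t\<in>{0..}. g y t)" for y
    have lower: "- p (- y) \<le> g y t" if "0 \<le> t" for y t
      using sublinear_add_le[OF p, of "y + t *\<^sub>R v" "- y"] sublinear_scaleR[OF p that, of v]
      by (simp add: g_def)
    have q_le: "q y \<le> g y t" if "0 \<le> t" for y t
      unfolding q_def using that lower by (intro cINF_lower bdd_belowI2[of _ "- p (- y)"]) auto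
    have q_ge: "c \<le> q y" if "\<And>t. 0 \<le> t \<Longrightarrow> c \<le> g y t" for c y
      unfolding q_def using that by (intro cINF_greatest) auto
    have "sublinear q"
    proof (rule sublinearI)
      fix y z
      \<comment> \<open>The parameter \<open>s + t\<close> splits the argument as
        \<open>(y + s v) + (z + t v)\<close>.\<close>
      have "q (y + z) - g z t \<le> g y s" if "0 \<le> s" "0 \<le> t" for s t
        using q_le[of "s + t" "y + z"] that sublinear_add_le[OF p, of "y + s *\<^sub>R v" "z + t *\<^sub>R v"]
        by (simp add: g_def algebra_simps)
      then have "q (y + z) - g z t \<le> q y" if "0 \<le> t" for t
        using that by (intro q_ge)
      then have "q (y + z) - q y \<le> q z"
        by (intro q_ge) (simp add: algebra_simps)
      then show "q (y + z) \<le> q y + q z" by simp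
    next
      fix r :: real and y assume r: "0 < r"
      have "q (r *\<^sub>R y) / r \<le> g y t" if "0 \<le> t" for t
        using q_le[of "r * t" "r *\<^sub>R y"] that r sublinear_scaleR[OF p, of r "y + t *\<^sub>R v"]
        by (simp add: g_def field_simps scaleR_add_right)
      then have "q (r *\<^sub>R y) / r \<le> q y" by (rule q_ge)
      then show "q (r *\<^sub>R y) \<le> r * q y" using r by (simp add: field_simps)
    qed
    moreover have "q y \<le> p y" for y
      using q_le[of 0 y] by (simp add: g_def)
    ultimately have "q = p" by (rule min)
    then show ?thesis
      using q_le[of 1 x] by (simp add: g_def)
  qed
  then have add: "p (x + y) = p x + p y" for x y
    using sublinear_add_le[OF p] by (meson antisym)
  have neg: "p (- x) = - p x" for x
    using add[of x "- x"] sublinear_zero[OF p] by simp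
  show ?thesis
  proof (rule linearI[OF add])
    fix r x
    show "p (r *\<^sub>R x) = r *\<^sub>R p x"
      using sublinear_scaleR[OF p, of r x] sublinear_scaleR[OF p, of "- r" x] neg[of "r *\<^sub>R x"]
      by (cases "0 \<le> r") auto
  qed
qed

theorem sublinear_dominates_linear:
  fixes p0 :: "'a::real_vector \<Rightarrow> real"
  assumes p0: "sublinear p0"
  obtains f where "linear f" "\<And>x. f x \<le> p0 x"
proof -
  define A where "A = {p. sublinear p \<and> p \<le> p0}"
  \<comment> \<open>The reversed order turns the maximal elements of Zorn's lemma into minimal
    functionals; chains are bounded by their pointwise infimum.\<close>
  let ?P = "\<lambda>p q :: 'a \<Rightarrow> real. q \<le> p"
  have "\<exists>m\<in>A. \<forall>a\<in>A. a \<le> m \<longrightarrow> a = m"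
  proof (rule predicate_Zorn)
    show "partial_order_on A (relation_of ?P A)"
      by (rule partial_order_on_relation_ofI) auto
    fix C assume C: "C \<in> Chains (relation_of ?P A)"
    then have CA: "p \<in> A" if "p \<in> C" for p
      using that by (auto simp: Chains_def relation_of_def)
    have total: "p \<le> q \<or> q \<le> p" if "p \<in> C" "q \<in> C" for p q
      using C that by (auto simp: Chains_def relation_of_def)
    show "\<exists>u\<in>A. \<forall>a\<in>C. u \<le> a"
    proof (cases "C = {}")
      case True
      then show ?thesis using p0 by (auto simp: A_def)
    next
      case False
      define u where "u x = (INF p\<in>C. p x)" for x
      have "- p0 (- x) \<le> p x" if "p \<in> C" for p x
      proof -
        have "p (- x) \<le> p0 (- x)" using CA[OF that] by (simp add: A_def le_fun_def)
        then show ?thesis using sublinear_minus_le[of p x] CA[OF that] by (simp add: A_def)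
      qed
      then have u_le: "u x \<le> p x" if "p \<in> C" for p x
        unfolding u_def using that by (intro cINF_lower bdd_belowI2[of _ "- p0 (- x)"]) auto
      have u_ge: "c \<le> u x" if "\<And>p. p \<in> C \<Longrightarrow> c \<le> p x" for c x
        unfolding u_def using that False by (intro cINF_greatest)
      have "sublinear u"
      proof (rule sublinearI)
        fix x y
        have "u (x + y) - q y \<le> p x" if pq: "p \<in> C" "q \<in> C" for p q
        proof -
          \<comment> \<open>The smaller of \<open>p\<close> and \<open>q\<close> lies below both, so
            subadditivity of a single member of the chain suffices.\<close>
          obtain r where r: "r \<in> C" "r x \<le> p x" "r y \<le> q y"
            using total[OF pq] pq by (auto simp: le_fun_def)
          then have "u (x + y) \<le> r x + r y"
            using u_le[of r "x + y"] CA[OF r(1)] by (auto simp: A_def sublinear_def intro: order_trans)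
          with r show ?thesis by linarith
        qed
        then have "u (x + y) - q y \<le> u x" if "q \<in> C" for q
          using that by (intro u_ge)
        then have "u (x + y) - u x \<le> u y"
          by (intro u_ge) (simp add: algebra_simps)
        then show "u (x + y) \<le> u x + u y" by simp
      next
        fix r :: real and x assume r: "0 < r"
        have "u (r *\<^sub>R x) / r \<le> p x" if "p \<in> C" for p
          using u_le[OF that, of "r *\<^sub>R x"] CA[OF that] r sublinear_scaleR[of p r x]
          by (simp add: A_def field_simps)
        then have "u (r *\<^sub>R x) / r \<le> u x" by (rule u_ge)
        then show "u (r *\<^sub>R x) \<le> r * u x" using r by (simp add: field_simps)
      qed
      moreover have "u \<le> p0"
        using False u_le CA by (fastforce simp: A_def le_fun_def intro: order_trans)
      ultimately show ?thesis using u_le by (auto simp: A_def le_fun_def)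
    qed
  qed
  then obtain m where m: "sublinear m" "m \<le> p0" and min: "\<And>q. q \<in> A \<Longrightarrow> q \<le> m \<Longrightarrow> q = m"
    by (auto simp: A_def)
  have "linear m"
  proof (rule minimal_sublinear_linear[OF m(1)])
    fix q assume "sublinear q" "\<And>x. q x \<le> m x"
    then show "q = m" using m(2) by (intro min) (auto simp: A_def le_fun_def intro: order_trans)
  qed
  with m(2) show thesis by (intro that[of m]) (auto simp: le_fun_def)
qed

section \<open>Support functionals and their assembly into a semi-inner product\<close>

lemma sublinear_rho_plus: "sublinear (rho_plus x)"
  by (rule sublinearI) (auto simp: rho_plus_subadditive rho_plus_scaleR)

text \<open>A real functional \<open>f\<close> below \<open>rho_plus y\<close> satisfies
  \<open>f y = (norm y)\<^sup>2\<close>, since \<open>rho_plus y\<close> takes opposite values at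
  \<open>y\<close> and \<open>- y\<close>. The complex functional is
  \<open>f u - \<i> * f (\<i> u)\<close>.\<close>

lemma support_functional_exists:
  fixes y :: "'a::complex_normed_vector"
  obtains \<phi> where "\<And>u v. \<phi> (u + v) = \<phi> u + \<phi> v" "\<And>a u. \<phi> (a *\<^sub>C u) = a * \<phi> u"
    "\<phi> y = complex_of_real ((norm y)\<^sup>2)" "\<And>u. cmod (\<phi> u) \<le> norm u * norm y"
proof -
  obtain f where f: "linear f" and f_le: "\<And>x. f x \<le> rho_plus y x"
    using sublinear_dominates_linear[OF sublinear_rho_plus[of y]] by blast
  define \<phi> where "\<phi> u = Complex (f u) (- f (\<i> *\<^sub>C u))" for u
  have add: "\<phi> (u + v) = \<phi> u + \<phi> v" for u v
    by (simp add: \<phi>_def scaleC_add_right linear_add[OF f] complex_eq_iff)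
  have f_scaleC: "f (a *\<^sub>C u) = Re a * f u + Im a * f (\<i> *\<^sub>C u)" for a u
  proof -
    have "a *\<^sub>C u = (of_real (Re a) + of_real (Im a) * \<i>) *\<^sub>C u"
      by (rule arg_cong[where f = "\<lambda>c. c *\<^sub>C u"]) (simp add: complex_eq_iff)
    also have "\<dots> = Re a *\<^sub>R u + Im a *\<^sub>R (\<i> *\<^sub>C u)"
      by (simp only: scaleC_add_left scaleC_of_real scaleC_scaleC[symmetric])
    finally show ?thesis by (simp add: linear_add[OF f] linear_scale[OF f])
  qed
  have scale: "\<phi> (a *\<^sub>C u) = a * \<phi> u" for a u
  proof -
    have "f (\<i> *\<^sub>C a *\<^sub>C u) = Re a * f (\<i> *\<^sub>C u) - Im a * f u"
      using f_scaleC[of "\<i> * a" u] by (simp add: scaleC_scaleC)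
    then show ?thesis using f_scaleC[of a u] by (simp add: \<phi>_def complex_eq_iff)
  qed
  have bound: "cmod (\<phi> u) \<le> norm u * norm y" for u
  proof -
    \<comment> \<open>A rotation making \<open>\<phi> u\<close> real and nonnegative, so the real
      bound on \<open>f\<close> controls the modulus.\<close>
    let ?c = "cnj (sgn (\<phi> u))"
    have "?c * \<phi> u = of_real (cmod (\<phi> u))"
      using complex_norm_square[of "\<phi> u"]
      by (cases "\<phi> u = 0") (simp_all add: sgn_eq field_simps power2_eq_square)
    then have "cmod (\<phi> u) = Re (\<phi> (?c *\<^sub>C u))"
      by (simp add: scale)
    also have "\<dots> \<le> norm y * norm (?c *\<^sub>C u)"
      using f_le[of "?c *\<^sub>C u"] rho_plus_le_norm[of y "?c *\<^sub>C u"] by (simp add: \<phi>_def)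
    also have "\<dots> \<le> norm y * norm u"
      by (intro mult_left_mono) (auto simp: norm_scaleC norm_sgn)
    finally show ?thesis by (simp add: mult.commute)
  qed
  have "f y = (norm y)\<^sup>2"
    using f_le[of y] f_le[of "- y"] rho_plus_scaleC_self[of y 1] rho_plus_scaleC_self[of y "- 1"]
    by (simp add: scaleC_one scaleC_minus_left linear_neg[OF f])
  then have Re: "Re (\<phi> y) = (norm y)\<^sup>2" by (simp add: \<phi>_def)
  \<comment> \<open>The modulus is at most the real part, which leaves no room for an imaginary
    part.\<close>
  have "(cmod (\<phi> y))\<^sup>2 \<le> ((norm y)\<^sup>2)\<^sup>2"
    using bound[of y] by (intro power_mono) (auto simp: power2_eq_square)
  then have "Im (\<phi> y) = 0"
    by (simp add: cmod_power2 Re)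
  with Re have "\<phi> y = complex_of_real ((norm y)\<^sup>2)"
    by (simp add: complex_eq_iff)
  then show thesis using that[of \<phi>] add scale bound by blast
qed

text \<open>Support functionals chosen separately for each \<open>y\<close> need not be homogeneous
  in \<open>y\<close>. One is therefore used per complex line, at a representative, and extended
  conjugate-linearly along that line.\<close>

lemma semi_inner_product_exists: "\<exists>s :: 'a::complex_normed_vector \<Rightarrow> 'a \<Rightarrow> complex. semi_inner_product s"
proof -
  have "\<exists>\<phi>. (\<forall>u v. \<phi> (u + v) = \<phi> u + \<phi> v) \<and> (\<forall>a u. \<phi> (a *\<^sub>C u) = a * \<phi> u) \<and>
    \<phi> y = complex_of_real ((norm y)\<^sup>2) \<and> (\<forall>u. cmod (\<phi> u) \<le> norm u * norm y)" for y :: 'a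
    by (rule support_functional_exists[of y]) blast
  then obtain \<Phi> where add: "\<And>y u v :: 'a. \<Phi> y (u + v) = \<Phi> y u + \<Phi> y v"
    and scale: "\<And>y a u. \<Phi> y (a *\<^sub>C u) = a * \<Phi> y u"
    and self: "\<And>y. \<Phi> y y = complex_of_real ((norm y)\<^sup>2)"
    and bound: "\<And>y u. cmod (\<Phi> y u) \<le> norm u * norm y"
    by metis
  \<comment> \<open>Nonzero factors only, so proportional nonzero vectors have the same set
    \<open>line\<close> and hence the same \<open>rep\<close>.\<close>
  define line where "line y = {a *\<^sub>C y |a. a \<noteq> 0}" for y :: 'a
  define rep where "rep y = (SOME e. e \<in> line y)" for y
  define coef where "coef y = (SOME c. y = c *\<^sub>C rep y)" for y
  have line_scaleC: "line (a *\<^sub>C y) = line y" if "a \<noteq> 0" for a y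
  proof -
    have "\<exists>c. b *\<^sub>C y = (c * a) *\<^sub>C y \<and> c \<noteq> 0" if "b \<noteq> 0" for b
      using that \<open>a \<noteq> 0\<close> by (intro exI[of _ "b / a"]) simp
    then show ?thesis
      using that unfolding line_def by (auto simp: scaleC_scaleC)
  qed
  have "rep y \<in> line y" for y
    unfolding rep_def by (rule someI[of _ "1 *\<^sub>C y"]) (auto simp: line_def intro!: exI[of _ 1])
  then have "\<exists>c. y = c *\<^sub>C rep y" for y
  proof -
    obtain a where a: "a \<noteq> 0" "rep y = a *\<^sub>C y"
      using \<open>rep y \<in> line y\<close> by (auto simp: line_def)
    then have "y = (1 / a) *\<^sub>C rep y"
      by (simp add: scaleC_scaleC scaleC_one)
    then show ?thesis ..
  qed
  then have coef: "coef y *\<^sub>C rep y = y" for y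
    unfolding coef_def by (metis (mono_tags, lifting) someI_ex)
  have norm_coef: "cmod (coef y) * norm (rep y) = norm y" for y
    using norm_scaleC[of "coef y" "rep y"] by (simp add: coef)
  define s where "s x y = cnj (coef y) * \<Phi> (rep y) x" for x y
  have s_bound: "cmod (s x y) \<le> norm x * norm y" for x y
  proof -
    have "cmod (s x y) \<le> cmod (coef y) * (norm x * norm (rep y))"
      unfolding s_def norm_mult complex_mod_cnj by (intro mult_left_mono bound) auto
    then show ?thesis
      using norm_coef[of y] by (metis mult.left_commute)
  qed
  have "s x (a *\<^sub>C y) = cnj a * s x y" for a x y
  proof (cases "a = 0 \<or> y = 0")
    case True
    \<comment> \<open>In the degenerate case the norm bound gives \<open>s x 0 = 0\<close>.\<close>
    then show ?thesis using s_bound[of x 0] by auto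
  next
    case False
    then have rep: "rep (a *\<^sub>C y) = rep y"
      by (simp add: rep_def line_scaleC)
    have "(coef (a *\<^sub>C y) - a * coef y) *\<^sub>C rep y = 0"
      using coef[of "a *\<^sub>C y"] coef[of y] by (simp add: rep scaleC_diff_left flip: scaleC_scaleC)
    moreover have "rep y \<noteq> 0"
      using coef[of y] False by auto
    ultimately have "coef (a *\<^sub>C y) = a * coef y"
      using norm_scaleC[of "coef (a *\<^sub>C y) - a * coef y" "rep y"] by simp
    then show ?thesis by (simp add: s_def rep)
  qed
  moreover have "s y y = complex_of_real ((norm y)\<^sup>2)" for y
  proof -
    have "s y y = cnj (coef y) * \<Phi> (rep y) (coef y *\<^sub>C rep y)"
      by (simp add: s_def coef)
    also have "\<dots> = complex_of_real ((cmod (coef y) * norm (rep y))\<^sup>2)"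
      using complex_norm_square[of "coef y"] by (simp add: scale self power_mult_distrib mult_ac)
    finally show ?thesis by (simp add: norm_coef)
  qed
  ultimately have "semi_inner_product s"
    using s_bound by (simp add: semi_inner_product_def s_def add scale algebra_simps)
  then show ?thesis by blast
qed

subsection \<open>Invariant semi-inner products\<close>

text \<open>Tychonoff: the functions bounded pointwise by \<open>b\<close> form a compact set, so a sequence in it
  has a cluster point, which inherits every closed condition.\<close>

lemma pointwise_bounded_cluster_point:
  fixes A :: "nat \<Rightarrow> 'i \<Rightarrow> complex"
  assumes "\<And>n i. cmod (A n i) \<le> b i"
  obtains s where "\<And>D. closed D \<Longrightarrow> eventually (\<lambda>n. A n \<in> D) sequentially \<Longrightarrow> s \<in> D"
proof -
  \<comment> \<open>The index type may be uncountable, so a cluster point of the image filter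
    replaces a convergent subsequence.\<close>
  let ?K = "PiE UNIV (\<lambda>i. cball (0 :: complex) (b i))" and ?F = "filtermap A sequentially"
  have "compact ?K"
    using compactin_PiE[of "\<lambda>_ :: 'i. euclidean :: complex topology" UNIV "\<lambda>i. cball 0 (b i)"]
    by (simp add: euclidean_product_topology)
  moreover have "eventually (\<lambda>s. s \<in> ?K) ?F" "?F \<noteq> bot"
    using assms by (auto simp: eventually_filtermap filtermap_bot_iff PiE_iff intro!: always_eventually)
  ultimately obtain s where s: "inf (nhds s) ?F \<noteq> bot"
    unfolding compact_filter by blast
  have "s \<in> D" if "closed D" "eventually (\<lambda>n. A n \<in> D) sequentially" for D
  proof (rule ccontr)
    assume "s \<notin> D"
    then have "eventually (\<lambda>x. x \<in> - D) (nhds s)"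
      using that(1) by (intro eventually_nhds_in_open) auto
    moreover have "eventually (\<lambda>x. x \<in> D) ?F"
      using that(2) by (simp add: eventually_filtermap)
    ultimately have "eventually (\<lambda>x. False) (inf (nhds s) ?F)"
      unfolding eventually_inf by blast
    with s show False by (simp add: trivial_limit_def)
  qed
  then show thesis by (rule that)
qed

text \<open>The averages over the first powers of \<open>U\<close> inherit every axiom and are
  invariant up to an error of order \<open>1 / n\<close>; a cluster point is exactly
  invariant.\<close>

lemma isometry_invariant_semi_inner_product:
  fixes U :: "'a::complex_normed_vector \<Rightarrow> 'a"
  assumes add: "\<And>x y. U (x + y) = U x + U y" and scale: "\<And>a x. U (a *\<^sub>C x) = a *\<^sub>C U x"
    and iso: "\<And>x. norm (U x) = norm x"
  obtains s where "semi_inner_product s" "\<And>x y. s (U x) (U y) = s x y"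
proof -
  obtain s0 :: "'a \<Rightarrow> 'a \<Rightarrow> complex" where s0: "semi_inner_product s0"
    using semi_inner_product_exists by blast
  have iso_pow: "norm ((U ^^ k) x) = norm x" for k x
    by (induction k) (simp_all add: iso)
  have add_pow: "(U ^^ k) (x + y) = (U ^^ k) x + (U ^^ k) y" for k x y
    by (induction k) (simp_all add: add)
  have scale_pow: "(U ^^ k) (a *\<^sub>C x) = a *\<^sub>C (U ^^ k) x" for k a x
    by (induction k) (simp_all add: scale)
  define g where "g k x y = s0 ((U ^^ k) x) ((U ^^ k) y)" for k x y
  have g_bound: "cmod (g k x y) \<le> norm x * norm y" for k x y
    using s0 iso_pow unfolding g_def semi_inner_product_def by metis
  define A where "A n = (\<lambda>(x, y). (\<Sum>k<Suc n. g k x y) / of_nat (Suc n))" for n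
  have A_bound: "cmod (A n p) \<le> norm (fst p) * norm (snd p)" for n p
  proof (cases p)
    case (Pair x y)
    have "cmod (\<Sum>k<Suc n. g k x y) \<le> of_nat (card {..<Suc n}) * (norm x * norm y)"
      by (rule sum_norm_bound) (rule g_bound)
    then show ?thesis
      by (simp add: Pair A_def norm_divide field_simps del: sum.lessThan_Suc of_nat_Suc)
  qed
  have A_lin: "A n (a *\<^sub>C x + y, z) = a * A n (x, z) + A n (y, z)" for n a x y z
  proof -
    have "g k (a *\<^sub>C x + y) z = a * g k x z + g k y z" for k
      using s0 by (simp add: g_def add_pow scale_pow semi_inner_product_def)
    then show ?thesis
      by (simp add: A_def sum.distrib sum_distrib_left add_divide_distrib del: sum.lessThan_Suc of_nat_Suc)
  qed
  have A_cnj: "A n (x, a *\<^sub>C y) = cnj a * A n (x, y)" for n a x y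
  proof -
    have "g k x (a *\<^sub>C y) = cnj a * g k x y" for k
      using s0 by (simp add: g_def scale_pow semi_inner_product_def)
    then show ?thesis
      by (simp add: A_def sum_distrib_left del: sum.lessThan_Suc of_nat_Suc)
  qed
  have A_self: "A n (x, x) = complex_of_real ((norm x)\<^sup>2)" for n x
  proof -
    have "g k x x = complex_of_real ((norm x)\<^sup>2)" for k
      using s0 by (simp add: g_def iso_pow semi_inner_product_def)
    then show ?thesis
      by (simp add: A_def del: sum.lessThan_Suc of_nat_Suc)
  qed
  have A_shift: "cmod (A n (U x, U y) - A n (x, y)) \<le> 2 * (norm x * norm y) / real (Suc n)" for n x y
  proof -
    have "g k (U x) (U y) = g (Suc k) x y" for k
      by (simp add: g_def funpow_swap1)
    \<comment> \<open>Applying \<open>U\<close> shifts the sum by one index, so only the two end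
      terms survive.\<close>
    then have "A n (U x, U y) - A n (x, y) = (g (Suc n) x y - g 0 x y) / of_nat (Suc n)"
      using sum_lessThan_telescope[of "\<lambda>k. g k x y" "Suc n"]
      by (simp add: A_def sum_subtractf del: sum.lessThan_Suc of_nat_Suc flip: diff_divide_distrib)
    moreover have "cmod (g (Suc n) x y - g 0 x y) \<le> 2 * (norm x * norm y)"
      using norm_triangle_ineq4[of "g (Suc n) x y" "g 0 x y"] g_bound[of "Suc n" x y] g_bound[of 0 x y]
      by linarith
    ultimately show ?thesis
      by (simp add: norm_divide divide_right_mono del: of_nat_Suc)
  qed
  obtain s where s: "\<And>D. closed D \<Longrightarrow> eventually (\<lambda>n. A n \<in> D) sequentially \<Longrightarrow> s \<in> D"
    using pointwise_bounded_cluster_point[of A "\<lambda>p. norm (fst p) * norm (snd p)"] A_bound by blast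
  \<comment> \<open>Each axiom instance involves finitely many evaluations, hence is a closed
    condition in the product topology.\<close>
  have "s (a *\<^sub>C x + y, z) = a * s (x, z) + s (y, z)" for a x y z
    using s[of "{f. f (a *\<^sub>C x + y, z) = a * f (x, z) + f (y, z)}"]
    by (simp add: A_lin closed_Collect_eq continuous_on_mult_left continuous_on_add)
  moreover have "s (x, a *\<^sub>C y) = cnj a * s (x, y)" for a x y
    using s[of "{f. f (x, a *\<^sub>C y) = cnj a * f (x, y)}"]
    by (simp add: A_cnj closed_Collect_eq continuous_on_mult_left)
  moreover have "s (x, x) = complex_of_real ((norm x)\<^sup>2)" for x
    using s[of "{f. f (x, x) = complex_of_real ((norm x)\<^sup>2)}"]
    by (simp add: A_self closed_Collect_eq)
  moreover have "cmod (s (x, y)) \<le> norm x * norm y" for x y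
    using s[of "{f. cmod (f (x, y)) \<le> norm x * norm y}"] A_bound[of _ "(x, y)"]
    by (simp add: closed_Collect_le continuous_on_norm)
  ultimately have "semi_inner_product (\<lambda>x y. s (x, y))"
    by (simp add: semi_inner_product_def)
  moreover have "s (U x, U y) = s (x, y)" for x y
  proof -
    \<comment> \<open>For fixed \<open>e\<close> the closed condition holds eventually along the
      averages and passes to \<open>s\<close>; then \<open>e\<close> is arbitrary.\<close>
    have "cmod (s (U x, U y) - s (x, y)) \<le> 0 + e" if "0 < e" for e
    proof -
      have "(\<lambda>n. 2 * (norm x * norm y) / real (Suc n)) \<longlonglongrightarrow> 0"
        by real_asymp
      then have "eventually (\<lambda>n. 2 * (norm x * norm y) / real (Suc n) < e) sequentially"
        using that by (rule order_tendstoD)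
      then have "eventually (\<lambda>n. A n \<in> {f. cmod (f (U x, U y) - f (x, y)) \<le> e}) sequentially"
        by eventually_elim (use A_shift[of _ x y] in \<open>auto intro: order_trans less_imp_le\<close>)
      then have "s \<in> {f. cmod (f (U x, U y) - f (x, y)) \<le> e}"
        by (intro s closed_Collect_le continuous_on_norm continuous_on_diff) auto
      then show ?thesis by simp
    qed
    then have "cmod (s (U x, U y) - s (x, y)) \<le> 0"
      by (rule field_le_epsilon)
    then show ?thesis by simp
  qed
  ultimately show thesis by (rule that)
qed

text \<open>Dividing \<open>S\<close> by \<open>c\<close> gives an isometry; the factor returns
  squared, once from each slot.\<close>

lemma similarity_imp_semi_inner_product:
  fixes S :: "'a::complex_normed_vector \<Rightarrow> 'a"
  assumes "bounded_clinear S" "0 < c" "\<And>x. norm (S x) = c * norm x"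
  shows "\<exists>s. semi_inner_product s \<and> (\<forall>x y. s (S x) (S y) = complex_of_real (c\<^sup>2) * s x y)"
proof -
  interpret S: bounded_clinear S by fact
  define U where "U x = complex_of_real (1 / c) *\<^sub>C S x" for x
  have U: "U (x + y) = U x + U y" "U (a *\<^sub>C x) = a *\<^sub>C U x" "norm (U x) = norm x" for a x y
    using assms(2,3) by (simp_all add: U_def S.add S.scaleC scaleC_add_right scaleC_scaleC norm_scaleC norm_divide mult.commute)
  obtain s where s: "semi_inner_product s" "\<And>x y. s (U x) (U y) = s x y"
    using isometry_invariant_semi_inner_product[of U, OF U] by blast
  have left: "s (a *\<^sub>C x) y = a * s x y" for a x y
  proof -
    \<comment> \<open>The second identity forces \<open>s 0 y = 0\<close>, which isolates
      homogeneity from the combined linearity axiom.\<close>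
    have "s (a *\<^sub>C x + 0) y = a * s x y + s 0 y" and "s (1 *\<^sub>C 0 + 0) y = 1 * s 0 y + s 0 y"
      using s(1) unfolding semi_inner_product_def by blast+
    then show ?thesis by simp
  qed
  have right: "s x (a *\<^sub>C y) = cnj a * s x y" for a x y
    using s(1) by (simp add: semi_inner_product_def)
  have "S x = complex_of_real c *\<^sub>C U x" for x
    using assms(2) by (simp add: U_def scaleC_scaleC scaleC_one)
  then have "s (S x) (S y) = complex_of_real (c\<^sup>2) * s x y" for x y
    by (simp add: left right s(2) power2_eq_square)
  with s(1) show ?thesis by blast
qed

lemma semi_inner_product_imp_similarity:
  assumes "semi_inner_product s" "s (S x) (S x) = complex_of_real (c\<^sup>2) * s x x" "0 \<le> c"
  shows "norm (S x) = c * norm x"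
proof -
  have "complex_of_real ((norm (S x))\<^sup>2) = complex_of_real (c\<^sup>2) * complex_of_real ((norm x)\<^sup>2)"
    using assms(1,2) by (simp add: semi_inner_product_def)
  then have "(norm (S x))\<^sup>2 = (c * norm x)\<^sup>2"
    by (metis of_real_eq_iff of_real_mult power_mult_distrib)
  then show ?thesis using assms(3) by simp
qed

theorem theorem5p4:
  fixes T :: "'a::complex_normed_vector \<Rightarrow> 'b::complex_normed_vector"
    and S :: "'a \<Rightarrow> 'a"
  shows
    "(bounded_clinear T \<and> T \<noteq> (\<lambda>x. 0) \<longrightarrow>
        (preserves_rho_inf_orthogonality T \<longleftrightarrow> (\<forall>x. norm (T x) = onorm T * norm x)) \<and>
        ((\<forall>x. norm (T x) = onorm T * norm x) \<longleftrightarrow>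
         (\<forall>x y. rho_inf (T x) (T y) = complex_of_real ((onorm T)\<^sup>2) * rho_inf x y))) \<and>
     (bounded_clinear S \<and> S \<noteq> (\<lambda>x. 0) \<longrightarrow>
        (preserves_rho_inf_orthogonality S \<longleftrightarrow> (\<forall>x. norm (S x) = onorm S * norm x)) \<and>
        ((\<forall>x. norm (S x) = onorm S * norm x) \<longleftrightarrow>
         (\<forall>x y. rho_inf (S x) (S y) = complex_of_real ((onorm S)\<^sup>2) * rho_inf x y)) \<and>
        ((\<forall>x y. rho_inf (S x) (S y) = complex_of_real ((onorm S)\<^sup>2) * rho_inf x y) \<longleftrightarrow>
         (\<exists>s. semi_inner_product s \<and>
              (\<forall>x y. s (S x) (S y) = complex_of_real ((onorm S)\<^sup>2) * s x y))))"
proof (intro conjI[of "_ \<longrightarrow> _"] impI; elim conjE)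
  assume "bounded_clinear T" "T \<noteq> (\<lambda>x. 0)"
  then show "(preserves_rho_inf_orthogonality T \<longleftrightarrow> (\<forall>x. norm (T x) = onorm T * norm x)) \<and>
      ((\<forall>x. norm (T x) = onorm T * norm x) \<longleftrightarrow>
       (\<forall>x y. rho_inf (T x) (T y) = complex_of_real ((onorm T)\<^sup>2) * rho_inf x y))"
    by (intro conjI bounded_clinear.rho_inf_equivalences)
next
  assume S: "bounded_clinear S" "S \<noteq> (\<lambda>x. 0)"
  interpret S: bounded_clinear S by fact
  \<comment> \<open>Positivity permits rescaling \<open>S\<close> to an isometry.\<close>
  have onorm: "0 < onorm S"
    using S(2) onorm_pos_lt[OF S.bounded_linear_axioms] by auto
  have "(\<forall>x. norm (S x) = onorm S * norm x) \<longleftrightarrow>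
      (\<exists>s. semi_inner_product s \<and> (\<forall>x y. s (S x) (S y) = complex_of_real ((onorm S)\<^sup>2) * s x y))"
    using similarity_imp_semi_inner_product[OF S(1) onorm] semi_inner_product_imp_similarity[where c = "onorm S" and S = S]
      onorm by (meson less_imp_le)
  with S.rho_inf_equivalences[OF S(2)]
  show "(preserves_rho_inf_orthogonality S \<longleftrightarrow> (\<forall>x. norm (S x) = onorm S * norm x)) \<and>
      ((\<forall>x. norm (S x) = onorm S * norm x) \<longleftrightarrow>
       (\<forall>x y. rho_inf (S x) (S y) = complex_of_real ((onorm S)\<^sup>2) * rho_inf x y)) \<and>
      ((\<forall>x y. rho_inf (S x) (S y) = complex_of_real ((onorm S)\<^sup>2) * rho_inf x y) \<longleftrightarrow>
       (\<exists>s. semi_inner_product s \<and>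
          (\<forall>x y. s (S x) (S y) = complex_of_real ((onorm S)\<^sup>2) * s x y)))"
    by simp
qed

end
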